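(* Let $G$ be a finite centerless group. Then $N_{\mathrm{Sym}(G)}(\mathrm{InHol}(G))=\langle \mathrm{Hol}(G),\mathrm{inv}_G\rangle$ if and only if $G$ is indecomposable.
   Context: A group $G$ is centerless if its center $Z(G)$ is trivial. A group $G$ is indecomposable if it cannot be written as a direct product $G=H\times K$ (internal) of two proper normal subgroups $H,K$ of $G$. $\mathrm{Sym}(G)$ is the group of all permutations of the set $G$. The left and right regular representations are the homomorphisms $\lambda,\rho:G\to\mathrm{Sym}(G)$ given by $\lambda(g)(x)=gx$ and $\rho(g)(x)=xg^{-1}$. The holomorph of $G$ is $\mathrm{Hol}(G)=\lambda(G)\rtimes\mathrm{Aut}(G)=\rho(G)\rtimes\mathrm{Aut}(G)\leq\mathrm{Sym}(G)$. The inner holomorph of $G$ is $\mathrm{InHol}(G)=\lambda(G)\rho(G)=\lambda(G)\rtimes\mathrm{Inn}(G)\leq\mathrm{Sym}(G)$, where $\mathrm{Inn}(G)$ is the group of inner automorphisms of $G$. The inversion map $\mathrm{inv}_G\in\mathrm{Sym}(G)$ is defined by $\mathrm{inv}_G(g)=g^{-1}$. $N_{\mathrm{Sym}(G)}(\cdot)$ denotes the normalizer in $\mathrm{Sym}(G)$. *)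

theory Defs
  imports "HOL-Algebra.Group_Action" "HOL-Algebra.Generated_Groups"
begin

(* Sym(G) is BijGroup (carrier G).  Its elements are extensional functions, so every
   permutation of carrier G defined below is restricted to carrier G.
   Aut(G) is the library's auto G, a subset of the carrier of Sym(G). *)

definition center :: "('a, 'b) monoid_scheme \<Rightarrow> 'a set"
  where "center G = {z \<in> carrier G. \<forall>g \<in> carrier G. z \<otimes>\<^bsub>G\<^esub> g = g \<otimes>\<^bsub>G\<^esub> z}"

definition centerless :: "('a, 'b) monoid_scheme \<Rightarrow> bool"
  where "centerless G \<longleftrightarrow> center G = {\<one>\<^bsub>G\<^esub>}"

(* A proper subgroup is one different from G; in particular, the trivial group, which
   has no proper subgroup, is indecomposable. *)
definition indecomposable :: "('a, 'b) monoid_scheme \<Rightarrow> bool"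
  where "indecomposable G \<longleftrightarrow>
    \<not> (\<exists>H K. H \<lhd> G \<and> K \<lhd> G \<and> H \<noteq> carrier G \<and> K \<noteq> carrier G \<and>
           H <#>\<^bsub>G\<^esub> K = carrier G \<and> H \<inter> K = {\<one>\<^bsub>G\<^esub>})"

definition left_regular :: "('a, 'b) monoid_scheme \<Rightarrow> 'a \<Rightarrow> 'a \<Rightarrow> 'a"
  where "left_regular G g = (\<lambda>x \<in> carrier G. g \<otimes>\<^bsub>G\<^esub> x)"

definition right_regular :: "('a, 'b) monoid_scheme \<Rightarrow> 'a \<Rightarrow> 'a \<Rightarrow> 'a"
  where "right_regular G g = (\<lambda>x \<in> carrier G. x \<otimes>\<^bsub>G\<^esub> inv\<^bsub>G\<^esub> g)"

definition inversion :: "('a, 'b) monoid_scheme \<Rightarrow> 'a \<Rightarrow> 'a"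
  where "inversion G = (\<lambda>x \<in> carrier G. inv\<^bsub>G\<^esub> x)"

(* An internal (semidirect) product of subgroups of Sym(G) is their product set. *)
definition Hol :: "('a, 'b) monoid_scheme \<Rightarrow> ('a \<Rightarrow> 'a) set"
  where "Hol G = left_regular G ` carrier G <#>\<^bsub>BijGroup (carrier G)\<^esub> auto G"

definition InHol :: "('a, 'b) monoid_scheme \<Rightarrow> ('a \<Rightarrow> 'a) set"
  where "InHol G =
    left_regular G ` carrier G <#>\<^bsub>BijGroup (carrier G)\<^esub> right_regular G ` carrier G"

context group
begin

lemma left_regular_Bij: "g \<in> carrier G \<Longrightarrow> left_regular G g \<in> Bij (carrier G)"
  unfolding Bij_def left_regular_def
  by (auto intro!: bij_betw_byWitness[where f' = "\<lambda>x. inv g \<otimes> x"] simp flip: m_assoc)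

lemma right_regular_Bij: "g \<in> carrier G \<Longrightarrow> right_regular G g \<in> Bij (carrier G)"
  unfolding Bij_def right_regular_def
  by (auto intro!: bij_betw_byWitness[where f' = "\<lambda>x. x \<otimes> g"] simp: m_assoc)

lemma inversion_Bij: "inversion G \<in> Bij (carrier G)"
  unfolding Bij_def inversion_def
  by (auto intro!: bij_betw_byWitness[where f' = "\<lambda>x. inv x"])

lemma left_regular_hom: "left_regular G \<in> hom G (BijGroup (carrier G))"
  by (rule homI)
     (auto simp: BijGroup_def left_regular_Bij,
      auto simp: left_regular_def compose_def m_assoc fun_eq_iff)

lemma right_regular_hom: "right_regular G \<in> hom G (BijGroup (carrier G))"
  by (rule homI)
     (auto simp: BijGroup_def right_regular_Bij,
      auto simp: right_regular_def compose_def m_assoc inv_mult_group fun_eq_iff)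

end

end

theory Submission
  imports Defs
begin

text \<open>
  Both $\mathrm{Hol}(G)$ and its coset by the inversion consist of the bijections $f$ that preserve
  or reverse the ternary operation $x y^{-1} z$, so the generated subgroup is the set of all such
  $f$, and the question is whether every $f$ normalizing the group of maps $x \mapsto g x h$ is one
  of them.

  If $G = H \times K$ is a proper decomposition, then $hk \mapsto h k^{-1}$ normalizes this group,
  but it preserves (reverses) the ternary operation only if $K$ (respectively $H$) is abelian, hence
  central, hence trivial.

  Conversely, for $f$ in the normalizer let $H$ (respectively $K$) be the set of those $g$ for which
  $f^{-1} \lambda(g) f$ is a left (respectively right) translation.  These are normal subgroups.
  As the center is trivial, they intersect trivially and $HK = G$, so one of them is $G$: this says
  that $f$ preserves or reverses the ternary operation.
\<close>

section \<open>Pointwise reasoning about permutations in \<open>BijGroup\<close>\<close>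

lemma BijGroup_mult_apply:
  "f \<in> Bij S \<Longrightarrow> g \<in> Bij S \<Longrightarrow> x \<in> S \<Longrightarrow> (f \<otimes>\<^bsub>BijGroup S\<^esub> g) x = f (g x)"
  by (simp add: BijGroup_def compose_def)

lemma carrier_BijGroup: "carrier (BijGroup S) = Bij S"
  by (simp add: BijGroup_def)

lemma BijGroup_mult_closed:
  "f \<in> Bij S \<Longrightarrow> g \<in> Bij S \<Longrightarrow> f \<otimes>\<^bsub>BijGroup S\<^esub> g \<in> Bij S"
  by (simp add: BijGroup_def compose_Bij)

lemma Bij_closed: "f \<in> Bij S \<Longrightarrow> x \<in> S \<Longrightarrow> f x \<in> S"
  by (auto dest: Bij_imp_funcset)

lemma Bij_surjE:
  assumes "f \<in> Bij S" "y \<in> S"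
  obtains x where "x \<in> S" "f x = y"
proof -
  have "y \<in> f ` S" using assms by (simp add: Bij_def bij_betw_def)
  then show ?thesis using that by blast
qed

lemma Bij_injD: "f \<in> Bij S \<Longrightarrow> f x = f y \<Longrightarrow> x \<in> S \<Longrightarrow> y \<in> S \<Longrightarrow> x = y"
  by (auto simp: Bij_def bij_betw_def inj_on_def)

lemma Bij_eqI:
  "f \<in> Bij S \<Longrightarrow> g \<in> Bij S \<Longrightarrow> (\<And>x. x \<in> S \<Longrightarrow> f x = g x) \<Longrightarrow> f = g"
  by (rule extensionalityI[where A = S]) (auto simp: Bij_def)

section \<open>Two-sided translations and the normalizer of the inner holomorph\<close>

context group
begin

text \<open>The library's \<open>normalizer\<close> is a stabilizer under conjugation of subsets.
  Moving \<open>inv g\<close> to the other side leaves an equality of cosets, in which no inverse in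
  the symmetric group has to be evaluated.\<close>

lemma mem_normalizer_iff:
  assumes "H \<subseteq> carrier G"
  shows "g \<in> normalizer G H \<longleftrightarrow> g \<in> carrier G \<and> g <# H = H #> g"
proof (cases "g \<in> carrier G")
  case g: True
  have sub: "g <# H \<subseteq> carrier G"
    using g assms by (auto simp: l_coset_def)
  have "g <# H #> inv g = H \<longleftrightarrow> g <# H = H #> g"
  proof
    assume "g <# H #> inv g = H"
    then have "g <# H #> inv g #> g = H #> g" by simp
    then show "g <# H = H #> g" using g sub by (simp add: coset_mult_assoc)
  next
    assume "g <# H = H #> g"
    then show "g <# H #> inv g = H" using g assms by (simp add: coset_mult_assoc)
  qed
  then show ?thesis using g assms by (simp add: normalizer_def stabilizer_def)
qed (simp add: normalizer_def stabilizer_def)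

text \<open>The right factor enters without an inverse, so this is \<lambda>(g)\<rho>(h^{-1}). As
  \<open>h\<close> runs through the group, the same set of permutations arises as with
  \<rho>(h).\<close>

definition translation :: "'a \<Rightarrow> 'a \<Rightarrow> 'a \<Rightarrow> 'a"
  where "translation g h = (\<lambda>x \<in> carrier G. g \<otimes> x \<otimes> h)"

lemma translation_eq:
  assumes "g \<in> carrier G" "h \<in> carrier G"
  shows "translation g h
    = left_regular G g \<otimes>\<^bsub>BijGroup (carrier G)\<^esub> right_regular G (inv h)"
  using assms left_regular_Bij[OF assms(1)] right_regular_Bij[of "inv h"]
  by (auto simp: BijGroup_def compose_def translation_def left_regular_def right_regular_def
      fun_eq_iff m_assoc)

lemma translation_Bij:
  "g \<in> carrier G \<Longrightarrow> h \<in> carrier G \<Longrightarrow> translation g h \<in> Bij (carrier G)"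
  by (simp add: translation_eq BijGroup_mult_closed left_regular_Bij right_regular_Bij)

lemma translation_apply: "x \<in> carrier G \<Longrightarrow> translation g h x = g \<otimes> x \<otimes> h"
  by (simp add: translation_def)

lemma InHol_eq: "InHol G = {translation g h | g h. g \<in> carrier G \<and> h \<in> carrier G}"
proof -
  have "left_regular G g \<otimes>\<^bsub>BijGroup (carrier G)\<^esub> right_regular G h = translation g (inv h)"
    if "g \<in> carrier G" "h \<in> carrier G" for g h
    using that by (simp add: translation_eq)
  then show ?thesis
    unfolding InHol_def set_mult_def
    by auto (metis inv_closed inv_inv)+
qed

text \<open>The last two conjuncts are the two inclusions between the cosets f InHol(G) and InHol(G)
  f, evaluated at points. From here on the normalizer is handled through equations in
  \<open>G\<close> alone.\<close>

lemma mem_normalizer_InHol_iff: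
  "f \<in> normalizer (BijGroup (carrier G)) (InHol G) \<longleftrightarrow>
    f \<in> Bij (carrier G) \<and>
    (\<forall>g \<in> carrier G. \<forall>h \<in> carrier G. \<exists>u \<in> carrier G. \<exists>v \<in> carrier G. \<forall>x \<in> carrier G.
       f (g \<otimes> x \<otimes> h) = u \<otimes> f x \<otimes> v) \<and>
    (\<forall>u \<in> carrier G. \<forall>v \<in> carrier G. \<exists>g \<in> carrier G. \<exists>h \<in> carrier G. \<forall>x \<in> carrier G.
       f (g \<otimes> x \<otimes> h) = u \<otimes> f x \<otimes> v)"
proof (cases "f \<in> Bij (carrier G)")
  case f: True
  let ?S = "BijGroup (carrier G)"
  have eq: "f \<otimes>\<^bsub>?S\<^esub> translation g h = translation u v \<otimes>\<^bsub>?S\<^esub> f \<longleftrightarrow>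
      (\<forall>x \<in> carrier G. f (g \<otimes> x \<otimes> h) = u \<otimes> f x \<otimes> v)"
    if "g \<in> carrier G" "h \<in> carrier G" "u \<in> carrier G" "v \<in> carrier G" for g h u v
  proof -
    have T: "translation g h \<in> Bij (carrier G)" "translation u v \<in> Bij (carrier G)"
      using that by (auto intro: translation_Bij)
    have "(f \<otimes>\<^bsub>?S\<^esub> translation g h) x = f (g \<otimes> x \<otimes> h)"
      "(translation u v \<otimes>\<^bsub>?S\<^esub> f) x = u \<otimes> f x \<otimes> v" if "x \<in> carrier G" for x
      using that f T by (auto simp: BijGroup_mult_apply translation_apply Bij_closed)
    then show ?thesis
      using f T by (metis Bij_eqI BijGroup_mult_closed)
  qed
  have sub: "InHol G \<subseteq> carrier ?S"
    by (auto simp: InHol_eq carrier_BijGroup intro: translation_Bij)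
  have "f \<in> normalizer ?S (InHol G) \<longleftrightarrow> f <#\<^bsub>?S\<^esub> InHol G = InHol G #>\<^bsub>?S\<^esub> f"
    using group.mem_normalizer_iff[OF group_BijGroup sub] f by (simp add: carrier_BijGroup)
  also have "\<dots> \<longleftrightarrow>
    (\<forall>g \<in> carrier G. \<forall>h \<in> carrier G. \<exists>u \<in> carrier G. \<exists>v \<in> carrier G.
       f \<otimes>\<^bsub>?S\<^esub> translation g h = translation u v \<otimes>\<^bsub>?S\<^esub> f) \<and>
    (\<forall>u \<in> carrier G. \<forall>v \<in> carrier G. \<exists>g \<in> carrier G. \<exists>h \<in> carrier G.
       f \<otimes>\<^bsub>?S\<^esub> translation g h = translation u v \<otimes>\<^bsub>?S\<^esub> f)"
    (is "_ \<longleftrightarrow> ?R")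
  proof
    assume eq: "f <#\<^bsub>?S\<^esub> InHol G = InHol G #>\<^bsub>?S\<^esub> f"
    show ?R
    proof (intro conjI ballI)
      fix g h assume "g \<in> carrier G" "h \<in> carrier G"
      then have "f \<otimes>\<^bsub>?S\<^esub> translation g h \<in> f <#\<^bsub>?S\<^esub> InHol G"
        by (auto simp: l_coset_def InHol_eq)
      then show "\<exists>u \<in> carrier G. \<exists>v \<in> carrier G.
          f \<otimes>\<^bsub>?S\<^esub> translation g h = translation u v \<otimes>\<^bsub>?S\<^esub> f"
        unfolding eq by (auto simp: r_coset_def InHol_eq)
    next
      fix u v assume "u \<in> carrier G" "v \<in> carrier G"
      then have "translation u v \<otimes>\<^bsub>?S\<^esub> f \<in> InHol G #>\<^bsub>?S\<^esub> f"
        by (auto simp: r_coset_def InHol_eq)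
      then show "\<exists>g \<in> carrier G. \<exists>h \<in> carrier G.
          f \<otimes>\<^bsub>?S\<^esub> translation g h = translation u v \<otimes>\<^bsub>?S\<^esub> f"
        unfolding eq[symmetric] by (fastforce simp: l_coset_def InHol_eq)
    qed
  next
    assume R: ?R
    show "f <#\<^bsub>?S\<^esub> InHol G = InHol G #>\<^bsub>?S\<^esub> f"
    proof
      show "f <#\<^bsub>?S\<^esub> InHol G \<subseteq> InHol G #>\<^bsub>?S\<^esub> f"
      proof
        fix t assume "t \<in> f <#\<^bsub>?S\<^esub> InHol G"
        then obtain g h where gh: "g \<in> carrier G" "h \<in> carrier G"
          and t: "t = f \<otimes>\<^bsub>?S\<^esub> translation g h"
          by (auto simp: l_coset_def InHol_eq)
        obtain u v where "u \<in> carrier G" "v \<in> carrier G" "t = translation u v \<otimes>\<^bsub>?S\<^esub> f"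
          using bspec[OF bspec[OF conjunct1[OF R] gh(1)] gh(2)] unfolding t by blast
        then show "t \<in> InHol G #>\<^bsub>?S\<^esub> f" by (auto simp: r_coset_def InHol_eq)
      qed
      show "InHol G #>\<^bsub>?S\<^esub> f \<subseteq> f <#\<^bsub>?S\<^esub> InHol G"
      proof
        fix t assume "t \<in> InHol G #>\<^bsub>?S\<^esub> f"
        then obtain u v where uv: "u \<in> carrier G" "v \<in> carrier G"
          and t: "t = translation u v \<otimes>\<^bsub>?S\<^esub> f"
          by (auto simp: r_coset_def InHol_eq)
        obtain g h where gh: "g \<in> carrier G" "h \<in> carrier G" "f \<otimes>\<^bsub>?S\<^esub> translation g h = t"
          using bspec[OF bspec[OF conjunct2[OF R] uv(1)] uv(2)] unfolding t by blast
        then have "translation g h \<in> InHol G" by (auto simp: InHol_eq)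
        with gh(3) show "t \<in> f <#\<^bsub>?S\<^esub> InHol G" unfolding l_coset_def by blast
      qed
    qed
  qed
  finally show ?thesis using f eq by (simp cong: bex_cong)
next
  case False
  then show ?thesis by (simp add: normalizer_def stabilizer_def carrier_BijGroup)
qed

section \<open>Heap maps and the subgroup generated by the holomorph and the inversion\<close>

text \<open>The ternary operation x y^{-1} z is the heap (torsor) structure underlying the group. It
  does not single out an identity element, so translations respect it as well as automorphisms
  do.\<close>

definition heap_hom :: "('a \<Rightarrow> 'a) \<Rightarrow> bool"
  where "heap_hom f \<longleftrightarrow> (\<forall>x \<in> carrier G. \<forall>y \<in> carrier G. \<forall>z \<in> carrier G.
    f (x \<otimes> inv y \<otimes> z) = f x \<otimes> inv (f y) \<otimes> f z)"

definition heap_antihom :: "('a \<Rightarrow> 'a) \<Rightarrow> bool"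
  where "heap_antihom f \<longleftrightarrow> (\<forall>x \<in> carrier G. \<forall>y \<in> carrier G. \<forall>z \<in> carrier G.
    f (x \<otimes> inv y \<otimes> z) = f z \<otimes> inv (f y) \<otimes> f x)"

lemma heap_hom_mult:
  assumes "heap_hom f" "x \<in> carrier G" "y \<in> carrier G"
  shows "f (x \<otimes> y) = f x \<otimes> inv (f \<one>) \<otimes> f y"
  using assms(1)[unfolded heap_hom_def, rule_format, of x \<one> y] assms(2,3) by simp

lemma heap_antihom_mult:
  assumes "heap_antihom f" "x \<in> carrier G" "y \<in> carrier G"
  shows "f (x \<otimes> y) = f y \<otimes> inv (f \<one>) \<otimes> f x"
  using assms(1)[unfolded heap_antihom_def, rule_format, of x \<one> y] assms(2,3) by simp

text \<open>The binary law applied to \<open>y\<close> and \<open>inv y\<close> determines f(y^{-1})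
  = f(1) f(y)^{-1} f(1). Expanding f(x y^{-1} z) by the binary law then cancels both copies of
  f(1).\<close>

lemma heap_homI:
  assumes f: "\<And>x. x \<in> carrier G \<Longrightarrow> f x \<in> carrier G"
    and m: "\<And>x y. x \<in> carrier G \<Longrightarrow> y \<in> carrier G \<Longrightarrow> f (x \<otimes> y) = f x \<otimes> inv (f \<one>) \<otimes> f y"
  shows "heap_hom f"
  unfolding heap_hom_def
proof (intro ballI)
  fix x y z assume c: "x \<in> carrier G" "y \<in> carrier G" "z \<in> carrier G"
  have "f y \<otimes> (inv (f \<one>) \<otimes> f (inv y)) = f \<one>"
    using m[of y "inv y"] c f by (simp add: m_assoc)
  then have "inv (f \<one>) \<otimes> f (inv y) = inv (f y) \<otimes> f \<one>"
    using c f by (simp add: inv_solve_left)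
  then have "f (inv y) = f \<one> \<otimes> inv (f y) \<otimes> f \<one>"
    using c f by (simp add: inv_solve_left' m_assoc)
  moreover have "inv a \<otimes> (a \<otimes> b) = b" if "a \<in> carrier G" "b \<in> carrier G" for a b
    using that by (simp flip: m_assoc)
  moreover have "a \<otimes> (inv a \<otimes> b) = b" if "a \<in> carrier G" "b \<in> carrier G" for a b
    using that by (simp flip: m_assoc)
  ultimately show "f (x \<otimes> inv y \<otimes> z) = f x \<otimes> inv (f y) \<otimes> f z"
    using c f by (simp add: m m_assoc)
qed

text \<open>Precomposing with inversion turns the reversed law into the direct one, so
  \<open>heap_homI\<close> applies to x \<mapsto> f(x^{-1}).\<close>

lemma heap_antihomI:
  assumes f: "\<And>x. x \<in> carrier G \<Longrightarrow> f x \<in> carrier G"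
    and m: "\<And>x y. x \<in> carrier G \<Longrightarrow> y \<in> carrier G \<Longrightarrow> f (x \<otimes> y) = f y \<otimes> inv (f \<one>) \<otimes> f x"
  shows "heap_antihom f"
proof -
  have "heap_hom (\<lambda>x. f (inv x))"
    by (rule heap_homI) (simp_all add: f m inv_mult_group)
  then have "f (inv (inv z \<otimes> inv (inv y) \<otimes> inv x)) = f (inv (inv z)) \<otimes> inv (f (inv (inv y))) \<otimes> f (inv (inv x))"
    if "x \<in> carrier G" "y \<in> carrier G" "z \<in> carrier G" for x y z
    unfolding heap_hom_def using that by blast
  then show ?thesis
    unfolding heap_antihom_def by (simp add: inv_mult_group m_assoc)
qed

text \<open>Composing with the left translation by f(1)^{-1} normalizes f to fix the identity, and a
  heap map fixing the identity is multiplicative. Hence f is \<lambda>(f(1)) after an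
  automorphism.\<close>

lemma heap_hom_imp_Hol:
  assumes f: "f \<in> Bij (carrier G)" and hom: "heap_hom f"
  shows "f \<in> Hol G"
proof -
  let ?a = "left_regular G (inv (f \<one>)) \<otimes>\<^bsub>BijGroup (carrier G)\<^esub> f"
  have c: "f x \<in> carrier G" if "x \<in> carrier G" for x
    using f that by (rule Bij_closed)
  have L: "left_regular G (inv (f \<one>)) \<in> Bij (carrier G)" "left_regular G (f \<one>) \<in> Bij (carrier G)"
    using c by (auto intro: left_regular_Bij)
  have a: "?a \<in> Bij (carrier G)" using L f by (simp add: BijGroup_mult_closed)
  have a_apply: "?a x = inv (f \<one>) \<otimes> f x" if "x \<in> carrier G" for x
    using that L f c by (simp add: BijGroup_mult_apply left_regular_def)
  have "?a \<in> hom G G"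
    using c heap_hom_mult[OF hom] by (intro homI) (auto simp: a_apply m_assoc)
  with a have "?a \<in> auto G" by (simp add: auto_def)
  moreover have "f = left_regular G (f \<one>) \<otimes>\<^bsub>BijGroup (carrier G)\<^esub> ?a"
    using f L a c
    by (intro Bij_eqI[of _ "carrier G"])
       (auto simp: BijGroup_mult_closed BijGroup_mult_apply a_apply left_regular_def
         simp flip: m_assoc)
  ultimately show ?thesis
    unfolding Hol_def set_mult_def using c by blast
qed

text \<open>For f = \<lambda>(g) a with a an automorphism, f(1) = g, so f(x) f(1)^{-1} f(y) = g a(x)
  a(y) = f(xy).\<close>

lemma Hol_imp_heap_hom:
  assumes "f \<in> Hol G"
  shows "f \<in> Bij (carrier G)" "heap_hom f"
proof -
  obtain g a where g: "g \<in> carrier G" and a: "a \<in> hom G G" "a \<in> Bij (carrier G)"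
    and f: "f = left_regular G g \<otimes>\<^bsub>BijGroup (carrier G)\<^esub> a"
    using assms by (auto simp: Hol_def set_mult_def auto_def)
  show "f \<in> Bij (carrier G)"
    using g a left_regular_Bij by (simp add: f BijGroup_mult_closed)
  have ac: "a x \<in> carrier G" if "x \<in> carrier G" for x
    using a(2) that by (rule Bij_closed)
  have f_apply: "f x = g \<otimes> a x" if "x \<in> carrier G" for x
    using that g a left_regular_Bij ac by (simp add: f BijGroup_mult_apply left_regular_def)
  have "a \<one> = \<one>" using a(1) by (simp add: hom_one is_group)
  moreover have "inv g \<otimes> (g \<otimes> b) = b" if "b \<in> carrier G" for b
    using g that by (simp flip: m_assoc)
  ultimately show "heap_hom f"
    using g a(1) ac by (intro heap_homI) (auto simp: f_apply hom_mult m_assoc)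
qed

lemma heap_antihom_inversion: "heap_antihom (inversion G)"
  by (auto simp: heap_antihom_def inversion_def inv_mult_group m_assoc)

text \<open>Order reversal behaves like a sign: composing two maps multiplies their signs, and an
  inverse has the sign of the original.\<close>

lemma subgroup_heap_maps:
  "subgroup {f \<in> Bij (carrier G). heap_hom f \<or> heap_antihom f} (BijGroup (carrier G))"
  (is "subgroup ?E ?S")
proof (rule group.subgroupI[OF group_BijGroup])
  show "?E \<subseteq> carrier ?S" by (auto simp: carrier_BijGroup)
  have "(\<lambda>x \<in> carrier G. x) \<in> ?E"
    by (auto simp: id_Bij heap_hom_def)
  then show "?E \<noteq> {}" by blast
next
  fix f assume f: "f \<in> ?E"
  then have fB: "f \<in> Bij (carrier G)" by simp
  define f' where "f' = inv\<^bsub>?S\<^esub> f"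
  have f'B: "f' \<in> Bij (carrier G)"
    using group.inv_closed[OF group_BijGroup, of f "carrier G"] fB by (simp add: f'_def carrier_BijGroup)
  have ff': "f (f' x) = x" if "x \<in> carrier G" for x
    using fB that by (auto simp: f'_def inv_BijGroup Bij_def bij_betw_def f_inv_into_f)
  have f'f: "f' (f x) = x" if "x \<in> carrier G" for x
    by (rule Bij_injD[OF fB]) (auto simp: ff' that fB f'B Bij_closed)
  have c: "f' x \<in> carrier G" if "x \<in> carrier G" for x
    using f'B that by (rule Bij_closed)
  have "heap_hom f' \<or> heap_antihom f'"
  proof (cases "heap_hom f")
    case True
    \<comment> \<open>This is the law of \<open>f\<close> at the points \<open>f' x\<close>,
      \<open>f' y\<close>, \<open>f' z\<close>, with \<open>f'\<close> applied to both
      sides.\<close>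
    have "f' (x \<otimes> inv y \<otimes> z) = f' x \<otimes> inv (f' y) \<otimes> f' z"
      if "x \<in> carrier G" "y \<in> carrier G" "z \<in> carrier G" for x y z
      using True that c f'f[of "f' x \<otimes> inv (f' y) \<otimes> f' z"] by (simp add: heap_hom_def ff')
    then have "heap_hom f'" by (simp add: heap_hom_def)
    then show ?thesis ..
  next
    case False
    then have "heap_antihom f" using f by blast
    then have "f' (x \<otimes> inv y \<otimes> z) = f' z \<otimes> inv (f' y) \<otimes> f' x"
      if "x \<in> carrier G" "y \<in> carrier G" "z \<in> carrier G" for x y z
      using that c f'f[of "f' z \<otimes> inv (f' y) \<otimes> f' x"] by (simp add: heap_antihom_def ff')
    then have "heap_antihom f'" by (simp add: heap_antihom_def)
    then show ?thesis ..
  qed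
  with f'B show "inv\<^bsub>?S\<^esub> f \<in> ?E" by (simp add: f'_def)
next
  fix f g assume fg: "f \<in> ?E" "g \<in> ?E"
  then have B: "f \<in> Bij (carrier G)" "g \<in> Bij (carrier G)" by auto
  have c: "g x \<in> carrier G" if "x \<in> carrier G" for x
    using B(2) that by (rule Bij_closed)
  have "heap_hom (f \<otimes>\<^bsub>?S\<^esub> g) \<or> heap_antihom (f \<otimes>\<^bsub>?S\<^esub> g)"
    using fg c by (auto simp: heap_hom_def heap_antihom_def BijGroup_mult_apply)
  with B show "f \<otimes>\<^bsub>?S\<^esub> g \<in> ?E" by (simp add: BijGroup_mult_closed)
qed

text \<open>The heap maps form a subgroup containing all generators. Conversely, an order-reversing
  f becomes order-preserving after precomposition with the inversion, hence lies in the holomorph,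
  and a second inversion restores f.\<close>

lemma generate_Hol_inversion:
  "generate (BijGroup (carrier G)) (Hol G \<union> {inversion G})
    = {f \<in> Bij (carrier G). heap_hom f \<or> heap_antihom f}"
  (is "generate ?S ?A = ?E")
proof
  show "generate ?S ?A \<subseteq> ?E"
    using Hol_imp_heap_hom heap_antihom_inversion inversion_Bij
    by (intro group.generate_subgroup_incl[OF group_BijGroup _ subgroup_heap_maps]) auto
  show "?E \<subseteq> generate ?S ?A"
  proof
    fix f assume f: "f \<in> ?E"
    then have fB: "f \<in> Bij (carrier G)" by simp
    let ?i = "inversion G"
    show "f \<in> generate ?S ?A"
    proof (cases "heap_hom f")
      case True
      then show ?thesis using fB by (simp add: generate.incl heap_hom_imp_Hol)
    next
      case False
      then have anti: "heap_antihom f" using f by blast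
      let ?g = "f \<otimes>\<^bsub>?S\<^esub> ?i"
      have g: "?g \<in> Bij (carrier G)" using fB inversion_Bij by (simp add: BijGroup_mult_closed)
      have "heap_hom ?g"
        unfolding heap_hom_def
      proof (intro ballI)
        fix x y z assume c: "x \<in> carrier G" "y \<in> carrier G" "z \<in> carrier G"
        have app: "?g w = f (inv w)" if "w \<in> carrier G" for w
          using that fB inversion_Bij by (simp add: BijGroup_mult_apply inversion_def)
        have "inv (x \<otimes> inv y \<otimes> z) = inv z \<otimes> inv (inv y) \<otimes> inv x"
          using c by (simp add: inv_mult_group m_assoc)
        then show "?g (x \<otimes> inv y \<otimes> z) = ?g x \<otimes> inv (?g y) \<otimes> ?g z"
          using anti c unfolding heap_antihom_def by (simp only: app inv_closed m_closed)
      qed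
      with g have "?g \<in> Hol G" by (rule heap_hom_imp_Hol)
      then have "?g \<otimes>\<^bsub>?S\<^esub> ?i \<in> generate ?S ?A"
        by (intro generate.eng generate.incl) auto
      moreover have "?g \<otimes>\<^bsub>?S\<^esub> ?i = f"
        using g fB inversion_Bij
        by (intro Bij_eqI[of _ "carrier G"])
           (auto simp: BijGroup_mult_closed BijGroup_mult_apply inversion_def)
      ultimately show ?thesis by simp
    qed
  qed
qed

section \<open>Heap maps normalize the inner holomorph\<close>

text \<open>Applying the law twice writes f(gxh) as f(x) with fixed factors on both sides: f(g)
  f(1)^{-1} on the left and f(1)^{-1} f(h) on the right, with \<open>g\<close> and \<open>h\<close>
  exchanged in the reversing case.\<close>

lemma heap_maps_normalize_InHol:
  assumes f: "f \<in> Bij (carrier G)" and "heap_hom f \<or> heap_antihom f"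
  shows "f \<in> normalizer (BijGroup (carrier G)) (InHol G)"
proof -
  have c: "f x \<in> carrier G" if "x \<in> carrier G" for x
    using f that by (rule Bij_closed)
  have s: "\<exists>x \<in> carrier G. f x = y" if "y \<in> carrier G" for y
    using Bij_surjE[OF f that] by blast
  from assms(2) show ?thesis
  proof
    assume hom: "heap_hom f"
    have e: "f (g \<otimes> x \<otimes> h) = (f g \<otimes> inv (f \<one>)) \<otimes> f x \<otimes> (inv (f \<one>) \<otimes> f h)"
      if "g \<in> carrier G" "x \<in> carrier G" "h \<in> carrier G" for g x h
      using that c by (simp add: heap_hom_mult[OF hom] m_assoc)
    show ?thesis
      unfolding mem_normalizer_InHol_iff
    proof (intro conjI ballI f)
      fix g h assume "g \<in> carrier G" "h \<in> carrier G"
      then show "\<exists>u \<in> carrier G. \<exists>v \<in> carrier G. \<forall>x \<in> carrier G. f (g \<otimes> x \<otimes> h) = u \<otimes> f x \<otimes> v"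
        using c e by (intro bexI[of _ "f g \<otimes> inv (f \<one>)"] bexI[of _ "inv (f \<one>) \<otimes> f h"]) auto
    next
      fix u v assume uv: "u \<in> carrier G" "v \<in> carrier G"
      \<comment> \<open>Surjectivity of \<open>f\<close> solves u = f(g) f(1)^{-1} and v = f(1)^{-1}
        f(h) for \<open>g\<close> and \<open>h\<close>.\<close>
      obtain g h where gh: "g \<in> carrier G" "h \<in> carrier G" "f g = u \<otimes> f \<one>" "f h = f \<one> \<otimes> v"
        using s[of "u \<otimes> f \<one>"] s[of "f \<one> \<otimes> v"] uv c by auto
      have "u = f g \<otimes> inv (f \<one>)" "v = inv (f \<one>) \<otimes> f h"
        using gh uv c by (simp_all add: m_assoc) (simp flip: m_assoc)
      then show "\<exists>g \<in> carrier G. \<exists>h \<in> carrier G. \<forall>x \<in> carrier G. f (g \<otimes> x \<otimes> h) = u \<otimes> f x \<otimes> v"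
        using gh(1,2) e by blast
    qed
  next
    assume hom: "heap_antihom f"
    have e: "f (g \<otimes> x \<otimes> h) = (f h \<otimes> inv (f \<one>)) \<otimes> f x \<otimes> (inv (f \<one>) \<otimes> f g)"
      if "g \<in> carrier G" "x \<in> carrier G" "h \<in> carrier G" for g x h
      using that c by (simp add: heap_antihom_mult[OF hom] m_assoc)
    show ?thesis
      unfolding mem_normalizer_InHol_iff
    proof (intro conjI ballI f)
      fix g h assume "g \<in> carrier G" "h \<in> carrier G"
      then show "\<exists>u \<in> carrier G. \<exists>v \<in> carrier G. \<forall>x \<in> carrier G. f (g \<otimes> x \<otimes> h) = u \<otimes> f x \<otimes> v"
        using c e by (intro bexI[of _ "f h \<otimes> inv (f \<one>)"] bexI[of _ "inv (f \<one>) \<otimes> f g"]) auto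
    next
      fix u v assume uv: "u \<in> carrier G" "v \<in> carrier G"
      obtain g h where gh: "g \<in> carrier G" "h \<in> carrier G" "f h = u \<otimes> f \<one>" "f g = f \<one> \<otimes> v"
        using s[of "u \<otimes> f \<one>"] s[of "f \<one> \<otimes> v"] uv c by auto
      have "u = f h \<otimes> inv (f \<one>)" "v = inv (f \<one>) \<otimes> f g"
        using gh uv c by (simp_all add: m_assoc) (simp flip: m_assoc)
      then show "\<exists>g \<in> carrier G. \<exists>h \<in> carrier G. \<forall>x \<in> carrier G. f (g \<otimes> x \<otimes> h) = u \<otimes> f x \<otimes> v"
        using gh(1,2) e by blast
    qed
  qed
qed

section \<open>A proper decomposition yields a normalizing permutation that is not a heap
  map\<close>

lemma centerlessD:
  assumes "centerless G" "z \<in> carrier G" "\<And>x. x \<in> carrier G \<Longrightarrow> z \<otimes> x = x \<otimes> z"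
  shows "z = \<one>"
  using assms unfolding centerless_def center_def by blast

text \<open>The commutator h k h^{-1} k^{-1} lies in both normal subgroups, hence is
  trivial.\<close>

lemma normal_disjoint_commute:
  assumes H: "H \<lhd> G" and K: "K \<lhd> G" and HK: "H \<inter> K = {\<one>}" and h: "h \<in> H" and k: "k \<in> K"
  shows "h \<otimes> k = k \<otimes> h"
proof -
  interpret H: normal H G by (rule H)
  interpret K: normal K G by (rule K)
  have c: "h \<in> carrier G" "k \<in> carrier G" using h k by auto
  have "h \<otimes> (k \<otimes> inv h \<otimes> inv k) \<in> H"
    using H.inv_op_closed2[of k "inv h"] h c by simp
  moreover have "(h \<otimes> k \<otimes> inv h) \<otimes> inv k \<in> K"
    using K.inv_op_closed2[of h k] k c by simp
  ultimately have "h \<otimes> k \<otimes> inv h \<otimes> inv k = \<one>"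
    using HK c by (auto simp: m_assoc)
  then have "h \<otimes> k \<otimes> inv (k \<otimes> h) = \<one>"
    using c by (simp add: inv_mult_group m_assoc)
  then show ?thesis
    using c by (simp add: inv_solve_right')
qed

lemma decomposable_imp_normalizer_not_heap_map:
  assumes Z: "centerless G" and H: "H \<lhd> G" and K: "K \<lhd> G"
    and proper: "H \<noteq> carrier G" "K \<noteq> carrier G"
    and prod: "H <#> K = carrier G" and HK: "H \<inter> K = {\<one>}"
  shows "\<exists>f \<in> normalizer (BijGroup (carrier G)) (InHol G). \<not> heap_hom f \<and> \<not> heap_antihom f"
proof -
  interpret H: normal H G by (rule H)
  interpret K: normal K G by (rule K)
  have comm: "h \<otimes> k = k \<otimes> h" if "h \<in> H" "k \<in> K" for h k
    using that by (rule normal_disjoint_commute[OF H K HK])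
  have "\<forall>x \<in> carrier G. \<exists>h k. h \<in> H \<and> k \<in> K \<and> x = h \<otimes> k"
    unfolding prod[symmetric] set_mult_def by blast
  then obtain p q where pq: "\<And>x. x \<in> carrier G \<Longrightarrow> p x \<in> H \<and> q x \<in> K \<and> x = p x \<otimes> q x"
    by metis
  have pH [simp]: "p x \<in> H" and qK [simp]: "q x \<in> K" if "x \<in> carrier G" for x
    using pq[OF that] by auto
  have pG [simp]: "p x \<in> carrier G" and qG [simp]: "q x \<in> carrier G" if "x \<in> carrier G" for x
    using that by simp_all
  have pq_comm: "p x \<otimes> q y = q y \<otimes> p x" "p x \<otimes> inv (q y) = inv (q y) \<otimes> p x"
    if "x \<in> carrier G" "y \<in> carrier G" for x y
    using that by (auto intro!: comm)
  \<comment> \<open>As rewrite rules together with associativity, these and \<open>pq_comm\<close>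
    sort a product by moving its \<open>K\<close>-components to the left of its
    \<open>H\<close>-components.\<close>
  have pq_lcomm: "p x \<otimes> (q y \<otimes> z) = q y \<otimes> (p x \<otimes> z)"
    "p x \<otimes> (inv (q y) \<otimes> z) = inv (q y) \<otimes> (p x \<otimes> z)"
    if "x \<in> carrier G" "y \<in> carrier G" "z \<in> carrier G" for x y z
    using that pq_comm[of x y] by (simp_all flip: m_assoc)
  have unique: "p (h \<otimes> k) = h \<and> q (h \<otimes> k) = k" if hk: "h \<in> H" "k \<in> K" for h k
  proof -
    let ?x = "h \<otimes> k"
    have c: "h \<in> carrier G" "k \<in> carrier G" "?x \<in> carrier G" using hk by auto
    have "p ?x \<otimes> q ?x = ?x" using pq c(3) by simp
    then have "inv h \<otimes> p ?x \<otimes> q ?x = k"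
      using c by (metis inv_closed inv_solve_left m_assoc m_closed pG qG)
    \<comment> \<open>The two sides lie in \<open>H\<close> and in \<open>K\<close> respectively, so
      both are trivial.\<close>
    then have e: "inv h \<otimes> p ?x = k \<otimes> inv (q ?x)"
      using c by (metis inv_closed inv_solve_right m_closed pG qG)
    have "inv h \<otimes> p ?x \<in> H" "k \<otimes> inv (q ?x) \<in> K" using c hk by simp_all
    then have "inv h \<otimes> p ?x = \<one>" "k \<otimes> inv (q ?x) = \<one>" using e HK by auto
    then show ?thesis
      using c by (metis inv_closed inv_equality inv_inv pG qG)
  qed
  define \<theta> where "\<theta> = (\<lambda>x \<in> carrier G. p x \<otimes> inv (q x))"
  have \<theta>_apply: "\<theta> x = p x \<otimes> inv (q x)" if "x \<in> carrier G" for x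
    using that by (simp add: \<theta>_def)
  have \<theta>_HK: "\<theta> (h \<otimes> k) = h \<otimes> inv k" if "h \<in> H" "k \<in> K" for h k
    using that unique[OF that] by (simp add: \<theta>_apply)
  have \<theta>_closed: "\<theta> x \<in> carrier G" if "x \<in> carrier G" for x
    using that by (simp add: \<theta>_apply)
  have \<theta>_invol: "\<theta> (\<theta> x) = x" if "x \<in> carrier G" for x
    using that pq[OF that] \<theta>_HK[of "p x" "inv (q x)"] by (simp add: \<theta>_apply[OF that])
  have \<theta>_Bij: "\<theta> \<in> Bij (carrier G)"
    unfolding Bij_def
  proof
    show "\<theta> \<in> extensional (carrier G)" by (simp add: \<theta>_def)
    show "\<theta> \<in> {f. bij_betw f (carrier G) (carrier G)}"
      using \<theta>_closed \<theta>_invol by (auto intro!: bij_betw_byWitness[where f' = \<theta>])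
  qed
  \<comment> \<open>Since \<open>\<theta>\<close> is the identity on \<open>H\<close> and inversion
    on \<open>K\<close>, it exchanges left and right only in the \<open>K\<close>-components: the
    left multiplier takes its \<open>K\<close>-part from \<open>h\<close>, the right one from
    \<open>g\<close>.\<close>
  have \<theta>_translation: "\<theta> (g \<otimes> x \<otimes> h) = (p g \<otimes> inv (q h)) \<otimes> \<theta> x \<otimes> (p h \<otimes> inv (q g))"
    if c: "g \<in> carrier G" "x \<in> carrier G" "h \<in> carrier G" for g x h
  proof -
    have "g \<otimes> x \<otimes> h = (p g \<otimes> q g) \<otimes> (p x \<otimes> q x) \<otimes> (p h \<otimes> q h)"
      using pq c by metis
    also have "\<dots> = (p g \<otimes> p x \<otimes> p h) \<otimes> (q g \<otimes> q x \<otimes> q h)"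
      using c by (simp add: m_assoc pq_comm pq_lcomm)
    finally have "\<theta> (g \<otimes> x \<otimes> h) = (p g \<otimes> p x \<otimes> p h) \<otimes> inv (q g \<otimes> q x \<otimes> q h)"
      using \<theta>_HK c by simp
    then show ?thesis
      using c by (simp add: \<theta>_apply m_assoc inv_mult_group pq_comm pq_lcomm)
  qed
  have "\<theta> \<in> normalizer (BijGroup (carrier G)) (InHol G)"
    unfolding mem_normalizer_InHol_iff
  proof (intro conjI ballI \<theta>_Bij)
    fix g h assume "g \<in> carrier G" "h \<in> carrier G"
    then show "\<exists>u \<in> carrier G. \<exists>v \<in> carrier G. \<forall>x \<in> carrier G. \<theta> (g \<otimes> x \<otimes> h) = u \<otimes> \<theta> x \<otimes> v"
      using \<theta>_translation
      by (intro bexI[of _ "p g \<otimes> inv (q h)"] bexI[of _ "p h \<otimes> inv (q g)"]) auto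
  next
    fix u v assume uv: "u \<in> carrier G" "v \<in> carrier G"
    \<comment> \<open>These solve \<open>\<theta>_translation\<close> for given multipliers: p(g) =
      p(u) and q(h) = q(u)^{-1} make the left multiplier p(u) q(u) = u, and the right one is p(v)
      q(v) = v in the same way.\<close>
    let ?g = "p u \<otimes> inv (q v)" and ?h = "p v \<otimes> inv (q u)"
    have gh: "?g \<in> carrier G" "?h \<in> carrier G" using uv by simp_all
    have "p ?g = p u" "q ?g = inv (q v)" "p ?h = p v" "q ?h = inv (q u)"
      using uv by (simp_all add: unique)
    then have "\<theta> (?g \<otimes> x \<otimes> ?h) = u \<otimes> \<theta> x \<otimes> v" if "x \<in> carrier G" for x
      using \<theta>_translation[OF gh(1) that gh(2)] uv pq by simp
    with gh show "\<exists>g \<in> carrier G. \<exists>h \<in> carrier G. \<forall>x \<in> carrier G. \<theta> (g \<otimes> x \<otimes> h) = u \<otimes> \<theta> x \<otimes> v"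
      by blast
  qed
  moreover have \<theta>_H: "\<theta> h = h" if "h \<in> H" for h
    using \<theta>_HK[of h \<one>] that by simp
  moreover have \<theta>_K: "\<theta> k = inv k" if "k \<in> K" for k
    using \<theta>_HK[of \<one> k] that by simp
  have \<theta>_one: "\<theta> \<one> = \<one>" using \<theta>_H by simp
  moreover have "\<not> heap_hom \<theta>"
  proof
    assume hom: "heap_hom \<theta>"
    \<comment> \<open>On \<open>K\<close> the map is inversion, which can be a homomorphism only on
      an abelian group.\<close>
    have abelian: "a \<otimes> b = b \<otimes> a" if "a \<in> K" "b \<in> K" for a b
    proof -
      have "inv (a \<otimes> b) = inv a \<otimes> inv b"
        using heap_hom_mult[OF hom, of a b] that by (simp add: \<theta>_K \<theta>_one)
      then have "inv (a \<otimes> b) = inv (b \<otimes> a)" using that by (simp add: inv_mult_group)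
      then show ?thesis using that by (metis K.mem_carrier inv_inv m_closed)
    qed
    have "k = \<one>" if "k \<in> K" for k
    proof (rule centerlessD[OF Z])
      fix x assume x: "x \<in> carrier G"
      have "k \<otimes> (p x \<otimes> q x) = (p x \<otimes> q x) \<otimes> k"
        using x that abelian[of k "q x"] comm[of "p x" k] by (metis K.mem_carrier m_assoc pG pH qG qK)
      then show "k \<otimes> x = x \<otimes> k" using pq[OF x] by simp
    qed (use that in simp)
    then have "x \<in> H" if "x \<in> carrier G" for x
      using pq[OF that] by (metis H.mem_carrier r_one)
    with proper(1) H.subset show False by blast
  qed
  moreover have "\<not> heap_antihom \<theta>"
  proof
    assume hom: "heap_antihom \<theta>"
    \<comment> \<open>On \<open>H\<close> the map is the identity, which can reverse products only
      on an abelian group.\<close>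
    have abelian: "a \<otimes> b = b \<otimes> a" if "a \<in> H" "b \<in> H" for a b
      using heap_antihom_mult[OF hom, of a b] that by (simp add: \<theta>_H \<theta>_one)
    have "h = \<one>" if "h \<in> H" for h
    proof (rule centerlessD[OF Z])
      fix x assume x: "x \<in> carrier G"
      have "h \<otimes> (p x \<otimes> q x) = (p x \<otimes> q x) \<otimes> h"
        using x that abelian[of h "p x"] comm[of h "q x"] by (metis H.mem_carrier m_assoc pG pH qG qK)
      then show "h \<otimes> x = x \<otimes> h" using pq[OF x] by simp
    qed (use that in simp)
    then have "x \<in> K" if "x \<in> carrier G" for x
      using pq[OF that] by (metis K.mem_carrier l_one)
    with proper(2) K.subset show False by blast
  qed
  ultimately show ?thesis by blast
qed

section \<open>In an indecomposable group the normalizer consists of heap maps\<close>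

lemma indecomposable_imp_normalizer_heap_map:
  assumes Z: "centerless G" and indec: "indecomposable G"
    and f: "f \<in> normalizer (BijGroup (carrier G)) (InHol G)"
  shows "heap_hom f \<or> heap_antihom f"
proof -
  have fB: "f \<in> Bij (carrier G)"
    and to_translation: "\<And>g h. g \<in> carrier G \<Longrightarrow> h \<in> carrier G \<Longrightarrow>
      \<exists>u \<in> carrier G. \<exists>v \<in> carrier G. \<forall>x \<in> carrier G. f (g \<otimes> x \<otimes> h) = u \<otimes> f x \<otimes> v"
    and from_translation: "\<And>u v. u \<in> carrier G \<Longrightarrow> v \<in> carrier G \<Longrightarrow>
      \<exists>g \<in> carrier G. \<exists>h \<in> carrier G. \<forall>x \<in> carrier G. f (g \<otimes> x \<otimes> h) = u \<otimes> f x \<otimes> v"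
    using f unfolding mem_normalizer_InHol_iff by blast+
  have c [simp]: "f x \<in> carrier G" if "x \<in> carrier G" for x
    using fB that by (rule Bij_closed)
  have inj: "x = y" if "f x = f y" "x \<in> carrier G" "y \<in> carrier G" for x y
    using Bij_injD[OF fB that] .
  have surj: "\<exists>x \<in> carrier G. f x = y" if "y \<in> carrier G" for y
    using Bij_surjE[OF fB that] by blast
  \<comment> \<open>\<open>L g a\<close> says that f^{-1} \<lambda>(g) f is left multiplication by
    \<open>a\<close>; \<open>R g a\<close> says that it is right multiplication by
    \<open>a\<close>.\<close>
  define L where "L g a \<longleftrightarrow> a \<in> carrier G \<and> (\<forall>x \<in> carrier G. f (a \<otimes> x) = g \<otimes> f x)" for g a
  define R where "R g a \<longleftrightarrow> a \<in> carrier G \<and> (\<forall>x \<in> carrier G. f (x \<otimes> a) = g \<otimes> f x)" for g a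
  define H where "H = {g \<in> carrier G. \<exists>a. L g a}"
  define K where "K = {g \<in> carrier G. \<exists>a. R g a}"
  have conj: "\<exists>u \<in> carrier G. \<exists>v \<in> carrier G. \<forall>x \<in> carrier G. f (u \<otimes> x \<otimes> v) = b \<otimes> f x"
    if "b \<in> carrier G" for b
    using from_translation[OF that one_closed] that by (auto cong: bex_cong)
  have cancel: "inv a \<otimes> (a \<otimes> b) = b" "a \<otimes> (inv a \<otimes> b) = b"
    if "a \<in> carrier G" "b \<in> carrier G" for a b
    using that by (simp_all flip: m_assoc)
  have L_inv: "L (inv g) (inv a)" if g: "g \<in> carrier G" and "L g a" for g a
  proof -
    have a: "a \<in> carrier G" and La: "\<And>x. x \<in> carrier G \<Longrightarrow> f (a \<otimes> x) = g \<otimes> f x"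
      using \<open>L g a\<close> by (auto simp: L_def)
    have "f (inv a \<otimes> x) = inv g \<otimes> f x" if x: "x \<in> carrier G" for x
      using La[of "inv a \<otimes> x"] a x g by (simp add: cancel)
    then show ?thesis using a by (simp add: L_def)
  qed
  have R_inv: "R (inv g) (inv a)" if g: "g \<in> carrier G" and "R g a" for g a
  proof -
    have a: "a \<in> carrier G" and Ra: "\<And>x. x \<in> carrier G \<Longrightarrow> f (x \<otimes> a) = g \<otimes> f x"
      using \<open>R g a\<close> by (auto simp: R_def)
    have "f (x \<otimes> inv a) = inv g \<otimes> f x" if x: "x \<in> carrier G" for x
      using Ra[of "x \<otimes> inv a"] a x g by (simp add: cancel m_assoc)
    then show ?thesis using a by (simp add: R_def)
  qed
  have L_mult: "L (g \<otimes> h) (a \<otimes> b)"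
    if "g \<in> carrier G" "h \<in> carrier G" "L g a" "L h b" for g h a b
    using that by (simp add: L_def m_assoc)
  \<comment> \<open>Right multiplications compose in the opposite order, hence the product of
    \<open>b\<close> and \<open>a\<close> here.\<close>
  have R_mult: "R (g \<otimes> h) (b \<otimes> a)"
    if "g \<in> carrier G" "h \<in> carrier G" "R g a" "R h b" for g h a b
    using that by (simp add: R_def m_assoc[symmetric])
  have one: "L \<one> \<one>" "R \<one> \<one>" by (simp_all add: L_def R_def)
  have normal_H: "H \<lhd> G"
    unfolding normal_inv_iff
  proof (intro conjI ballI)
    show "subgroup H G"
      using one L_inv L_mult unfolding H_def by (intro subgroupI; (auto; blast))
    fix b g assume b: "b \<in> carrier G" and "g \<in> H"
    then obtain a where g: "g \<in> carrier G" and a: "a \<in> carrier G"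
      and La: "\<And>x. x \<in> carrier G \<Longrightarrow> f (a \<otimes> x) = g \<otimes> f x"
      by (auto simp: H_def L_def)
    obtain u v where uv: "u \<in> carrier G" "v \<in> carrier G"
      and e: "\<And>x. x \<in> carrier G \<Longrightarrow> f (u \<otimes> x \<otimes> v) = b \<otimes> f x"
      using conj[OF b] by blast
    \<comment> \<open>The map T = f^{-1} \<lambda>(b) f is x \<mapsto> u x v. Conjugating the left
      multiplication by \<open>a\<close> with T leaves only the conjugate by \<open>u\<close>, as
      the right factor \<open>v\<close> cancels. Below, \<open>?y\<close> is T^{-1} x.\<close>
    have "L (b \<otimes> g \<otimes> inv b) (u \<otimes> a \<otimes> inv u)"
      unfolding L_def
    proof (intro conjI ballI)
      fix x assume x: "x \<in> carrier G"
      let ?y = "inv u \<otimes> x \<otimes> inv v"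
      have "f x = b \<otimes> f ?y"
        using e[of ?y] uv x by (simp add: m_assoc cancel)
      then have "f ?y = inv b \<otimes> f x"
        using b x uv by (simp add: cancel)
      moreover have "f (u \<otimes> a \<otimes> inv u \<otimes> x) = b \<otimes> f (a \<otimes> ?y)"
        using e[of "a \<otimes> ?y"] uv x a by (simp add: m_assoc)
      ultimately show "f (u \<otimes> a \<otimes> inv u \<otimes> x) = b \<otimes> g \<otimes> inv b \<otimes> f x"
        using La[of ?y] uv x b g by (simp add: m_assoc)
    qed (use uv a in simp)
    then show "b \<otimes> g \<otimes> inv b \<in> H" using b g by (auto simp: H_def)
  qed
  have normal_K: "K \<lhd> G"
    unfolding normal_inv_iff
  proof (intro conjI ballI)
    show "subgroup K G"
      using one R_inv R_mult unfolding K_def by (intro subgroupI; (auto; blast))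
    fix b g assume b: "b \<in> carrier G" and "g \<in> K"
    then obtain a where g: "g \<in> carrier G" and a: "a \<in> carrier G"
      and Ra: "\<And>x. x \<in> carrier G \<Longrightarrow> f (x \<otimes> a) = g \<otimes> f x"
      by (auto simp: K_def R_def)
    obtain u v where uv: "u \<in> carrier G" "v \<in> carrier G"
      and e: "\<And>x. x \<in> carrier G \<Longrightarrow> f (u \<otimes> x \<otimes> v) = b \<otimes> f x"
      using conj[OF b] by blast
    \<comment> \<open>Here the left factor \<open>u\<close> cancels, and conjugation by T = f^{-1}
      \<lambda>(b) f acts on \<open>a\<close> through \<open>v\<close> alone.\<close>
    have "R (b \<otimes> g \<otimes> inv b) (inv v \<otimes> a \<otimes> v)"
      unfolding R_def
    proof (intro conjI ballI)
      fix x assume x: "x \<in> carrier G"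
      let ?y = "inv u \<otimes> x \<otimes> inv v"
      have "f x = b \<otimes> f ?y"
        using e[of ?y] uv x by (simp add: m_assoc cancel)
      then have "f ?y = inv b \<otimes> f x"
        using b x uv by (simp add: cancel)
      moreover have "f (x \<otimes> (inv v \<otimes> a \<otimes> v)) = b \<otimes> f (?y \<otimes> a)"
        using e[of "?y \<otimes> a"] uv x a by (simp add: m_assoc cancel)
      ultimately show "f (x \<otimes> (inv v \<otimes> a \<otimes> v)) = b \<otimes> g \<otimes> inv b \<otimes> f x"
        using Ra[of ?y] uv x b g by (simp add: m_assoc)
    qed (use uv a in simp)
    then show "b \<otimes> g \<otimes> inv b \<in> K" using b g by (auto simp: K_def)
  qed
  have disjoint: "H \<inter> K = {\<one>}"
  proof
    show "{\<one>} \<subseteq> H \<inter> K" using one by (auto simp: H_def K_def)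
    show "H \<inter> K \<subseteq> {\<one>}"
    proof
      fix g assume "g \<in> H \<inter> K"
      then obtain a b where g: "g \<in> carrier G" and ab: "a \<in> carrier G" "b \<in> carrier G"
        and L: "\<And>x. x \<in> carrier G \<Longrightarrow> f (a \<otimes> x) = g \<otimes> f x"
        and R: "\<And>x. x \<in> carrier G \<Longrightarrow> f (x \<otimes> b) = g \<otimes> f x"
        by (auto simp: H_def K_def L_def R_def)
      \<comment> \<open>At x = 1 this gives a = b; then \<open>a\<close> is central, so a = 1, and g
        fixes f(1) under left multiplication.\<close>
      have e: "a \<otimes> x = x \<otimes> b" if "x \<in> carrier G" for x
        using L[OF that] R[OF that] that ab inj[of "a \<otimes> x" "x \<otimes> b"] by simp
      from e[of \<one>] ab have "a = b" by simp
      with e ab have "a = \<one>" by (intro centerlessD[OF Z]) auto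
      with L[of \<one>] g have "g = \<one>" by simp
      then show "g \<in> {\<one>}" by simp
    qed
  qed
  have central: "q = \<one>"
    if q: "q \<in> carrier G" and e: "\<And>w. w \<in> carrier G \<Longrightarrow> q \<otimes> w = w \<otimes> q" for q
    using that by (rule centerlessD[OF Z])
  text \<open>
    Conjugating by $f$ splits $\lambda(g) = cd$ with $c$ in the conjugate of the left and $d$ in that
    of the right translations.  Both factors commute with every right translation, because $cd$ does
    and the two conjugates commute and intersect trivially; so $c$ and $d$ are left translations.
\<close>
  have split: "g \<in> H <#> K" if g: "g \<in> carrier G" for g
  proof -
    obtain u v where uv: "u \<in> carrier G" "v \<in> carrier G"
      and fg: "\<And>x. x \<in> carrier G \<Longrightarrow> f (u \<otimes> x \<otimes> v) = g \<otimes> f x"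
      using conj[OF g] by blast
    \<comment> \<open>The pairs \<open>p\<close>, \<open>q\<close> and \<open>r\<close>,
      \<open>s\<close> describe the conjugates by f of left multiplication by \<open>u\<close> and
      of right multiplication by \<open>v\<close>. What has to be shown is q = s = 1.\<close>
    obtain p q where pq: "p \<in> carrier G" "q \<in> carrier G"
      and fu: "\<And>x. x \<in> carrier G \<Longrightarrow> f (u \<otimes> x) = p \<otimes> f x \<otimes> q"
      using to_translation[OF uv(1) one_closed] uv(1) by auto
    obtain r s where rs: "r \<in> carrier G" "s \<in> carrier G"
      and fv: "\<And>x. x \<in> carrier G \<Longrightarrow> f (x \<otimes> v) = r \<otimes> f x \<otimes> s"
      using to_translation[OF one_closed uv(2)] uv(2) by auto
    have commutes: "u' \<otimes> u = u \<otimes> u' \<and> v \<otimes> v' = v' \<otimes> v"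
      if w: "w \<in> carrier G" and u'v': "u' \<in> carrier G" "v' \<in> carrier G"
        and fw: "\<And>x. x \<in> carrier G \<Longrightarrow> f (u' \<otimes> x \<otimes> v') = f x \<otimes> w" for w u' v'
    proof -
      have eq: "u' \<otimes> u \<otimes> x \<otimes> (v \<otimes> v') = u \<otimes> u' \<otimes> x \<otimes> (v' \<otimes> v)" if x: "x \<in> carrier G" for x
      proof (rule inj)
        have "f (u' \<otimes> (u \<otimes> x \<otimes> v) \<otimes> v') = f (u \<otimes> (u' \<otimes> x \<otimes> v') \<otimes> v)"
          using x uv u'v' w g by (simp add: fg fw m_assoc[of g])
        then show "f (u' \<otimes> u \<otimes> x \<otimes> (v \<otimes> v')) = f (u \<otimes> u' \<otimes> x \<otimes> (v' \<otimes> v))"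
          using x uv u'v' by (simp add: m_assoc)
      qed (use x uv u'v' in simp_all)
      \<comment> \<open>The commutator \<open>z\<close> measures how far \<open>u\<close> and
        \<open>u'\<close> are from commuting. By \<open>eq\<close>, z x (v v') = x (v' v) for all x;
        comparing with x = 1 and cancelling v v' shows that \<open>z\<close> is central, and z = 1
        settles both commutations.\<close>
      define z where "z = inv (u \<otimes> u') \<otimes> (u' \<otimes> u)"
      have z: "z \<in> carrier G" using uv u'v' by (simp add: z_def)
      have zx: "z \<otimes> x \<otimes> (v \<otimes> v') = x \<otimes> (v' \<otimes> v)" if x: "x \<in> carrier G" for x
      proof -
        have "z \<otimes> x \<otimes> (v \<otimes> v') = inv (u \<otimes> u') \<otimes> (u' \<otimes> u \<otimes> x \<otimes> (v \<otimes> v'))"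
          using x uv u'v' by (simp add: z_def m_assoc)
        also have "\<dots> = x \<otimes> (v' \<otimes> v)"
          using eq[OF x] x uv u'v' cancel(1)[of "u \<otimes> u'" "x \<otimes> (v' \<otimes> v)"] by (simp add: m_assoc)
        finally show ?thesis .
      qed
      have "z = \<one>"
      proof (rule central[OF z])
        fix x assume x: "x \<in> carrier G"
        have "z \<otimes> x \<otimes> (v \<otimes> v') = x \<otimes> z \<otimes> (v \<otimes> v')"
          using zx[OF x] zx[of \<one>] x z uv u'v' by (simp add: m_assoc)
        then show "z \<otimes> x = x \<otimes> z" using x z uv u'v' by simp
      qed
      have "v \<otimes> v' = v' \<otimes> v" using zx[of \<one>] \<open>z = \<one>\<close> uv u'v' by simp
      moreover have "u' \<otimes> u = u \<otimes> u'"
        using cancel(2)[of "u \<otimes> u'" "u' \<otimes> u"] \<open>z = \<one>\<close> uv u'v' unfolding z_def by simp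
      ultimately show ?thesis by blast
    qed
    have right: "\<exists>u' \<in> carrier G. \<exists>v' \<in> carrier G. \<forall>x \<in> carrier G. f (u' \<otimes> x \<otimes> v') = f x \<otimes> w"
      if "w \<in> carrier G" for w
      using from_translation[OF one_closed that] that by (auto cong: bex_cong)
    have "q = \<one>"
    proof (rule central[OF pq(2)])
      fix w assume w: "w \<in> carrier G"
      obtain u' v' where u'v': "u' \<in> carrier G" "v' \<in> carrier G"
        and fw: "\<And>x. x \<in> carrier G \<Longrightarrow> f (u' \<otimes> x \<otimes> v') = f x \<otimes> w"
        using right[OF w] by blast
      \<comment> \<open>Left multiplication by \<open>u\<close> commutes with x \<mapsto> u' x v'.
        Applying \<open>f\<close> at the identity makes \<open>q\<close> commute with
        \<open>w\<close>.\<close>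
      have "u' \<otimes> (u \<otimes> \<one>) \<otimes> v' = u \<otimes> (u' \<otimes> \<one> \<otimes> v')"
        using commutes[OF w u'v' fw] uv u'v' by (simp flip: m_assoc)
      then have "p \<otimes> f \<one> \<otimes> q \<otimes> w = p \<otimes> (f \<one> \<otimes> w) \<otimes> q"
        using fw[of "u \<otimes> \<one>"] fu[of \<one>] fu[of "u' \<otimes> \<one> \<otimes> v'"] fw[of \<one>] uv u'v' by simp
      then have "p \<otimes> f \<one> \<otimes> (q \<otimes> w) = p \<otimes> f \<one> \<otimes> (w \<otimes> q)"
        using pq w by (simp add: m_assoc)
      then show "q \<otimes> w = w \<otimes> q" using pq w by simp
    qed
    have "s = \<one>"
    proof (rule central[OF rs(2)])
      fix w assume w: "w \<in> carrier G"
      obtain u' v' where u'v': "u' \<in> carrier G" "v' \<in> carrier G"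
        and fw: "\<And>x. x \<in> carrier G \<Longrightarrow> f (u' \<otimes> x \<otimes> v') = f x \<otimes> w"
        using right[OF w] by blast
      have "u' \<otimes> (\<one> \<otimes> v) \<otimes> v' = (u' \<otimes> \<one> \<otimes> v') \<otimes> v"
        using commutes[OF w u'v' fw] uv u'v' by (simp add: m_assoc)
      then have "r \<otimes> f \<one> \<otimes> s \<otimes> w = r \<otimes> (f \<one> \<otimes> w) \<otimes> s"
        using fw[of "\<one> \<otimes> v"] fv[of \<one>] fv[of "u' \<otimes> \<one> \<otimes> v'"] fw[of \<one>] uv u'v' by simp
      then have "r \<otimes> f \<one> \<otimes> (s \<otimes> w) = r \<otimes> f \<one> \<otimes> (w \<otimes> s)"
        using rs w by (simp add: m_assoc)
      then show "s \<otimes> w = w \<otimes> s" using rs w by simp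
    qed
    have "p \<in> H" using pq uv fu \<open>q = \<one>\<close> by (auto simp: H_def L_def)
    moreover have "r \<in> K" using rs uv fv \<open>s = \<one>\<close> by (auto simp: K_def R_def)
    moreover have "p \<otimes> r = g"
    proof -
      have "g \<otimes> f \<one> = p \<otimes> (r \<otimes> f \<one>)"
        using fg[of \<one>] fu[of v] fv[of \<one>] uv pq rs \<open>q = \<one>\<close> \<open>s = \<one>\<close> by simp
      then have "g \<otimes> f \<one> = p \<otimes> r \<otimes> f \<one>" using pq rs by (simp add: m_assoc)
      then show ?thesis using g pq rs by simp
    qed
    ultimately show ?thesis unfolding set_mult_def by blast
  qed
  have "H <#> K \<subseteq> carrier G" by (auto simp: set_mult_def H_def K_def)
  with split have "H <#> K = carrier G" by blast
  with indec normal_H normal_K disjoint have "H = carrier G \<or> K = carrier G"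
    unfolding indecomposable_def by blast
  then show ?thesis
  proof
    assume "H = carrier G"
    have "f (x \<otimes> y) = f x \<otimes> inv (f \<one>) \<otimes> f y" if x: "x \<in> carrier G" and y: "y \<in> carrier G" for x y
    proof -
      \<comment> \<open>This element is chosen because its left multiplication sends f(1) to f(x).
        The corresponding \<open>a\<close> then satisfies f(a) = f(x), and injectivity gives a =
        x.\<close>
      have "f x \<otimes> inv (f \<one>) \<in> H" using x \<open>H = carrier G\<close> by simp
      then obtain a where a: "a \<in> carrier G"
        and La: "\<And>z. z \<in> carrier G \<Longrightarrow> f (a \<otimes> z) = f x \<otimes> inv (f \<one>) \<otimes> f z"
        by (auto simp: H_def L_def)
      have "a = x" using La[of \<one>] a x inj[of a x] by (simp add: m_assoc)
      then show ?thesis using La y by simp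
    qed
    then show ?thesis by (intro disjI1 heap_homI) auto
  next
    assume "K = carrier G"
    have "f (x \<otimes> y) = f y \<otimes> inv (f \<one>) \<otimes> f x" if x: "x \<in> carrier G" and y: "y \<in> carrier G" for x y
    proof -
      \<comment> \<open>The factor that appears on the right in the source is now \<open>y\<close>,
        so the element sending f(1) to f(y) is taken.\<close>
      have "f y \<otimes> inv (f \<one>) \<in> K" using y \<open>K = carrier G\<close> by simp
      then obtain a where a: "a \<in> carrier G"
        and Ra: "\<And>z. z \<in> carrier G \<Longrightarrow> f (z \<otimes> a) = f y \<otimes> inv (f \<one>) \<otimes> f z"
        by (auto simp: K_def R_def)
      have "a = y" using Ra[of \<one>] a y inj[of a y] by (simp add: m_assoc)
      then show ?thesis using Ra x by simp
    qed
    then show ?thesis by (intro disjI2 heap_antihomI) auto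
  qed
qed

end

section \<open>The normalizer compared with the group of heap maps\<close>

theorem theorem2:
  fixes G :: "('a, 'b) monoid_scheme" (structure)
  assumes "group G" and "finite (carrier G)" and "centerless G"
  shows "normalizer (BijGroup (carrier G)) (InHol G)
           = generate (BijGroup (carrier G)) (Hol G \<union> {inversion G})
         \<longleftrightarrow> indecomposable G"
proof -
  interpret group G by (rule assms(1))
  let ?N = "normalizer (BijGroup (carrier G)) (InHol G)"
  let ?E = "{f \<in> Bij (carrier G). heap_hom f \<or> heap_antihom f}"
  have "?E \<subseteq> ?N"
    using heap_maps_normalize_InHol by blast
  \<comment> \<open>Elements of the normalizer are bijections, so only their heap property remains
    to be decided.\<close>
  then have "?N = ?E \<longleftrightarrow> (\<forall>f \<in> ?N. heap_hom f \<or> heap_antihom f)"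
    by (auto simp only: mem_normalizer_InHol_iff)
  also have "\<dots> \<longleftrightarrow> indecomposable G"
  proof
    assume "\<forall>f \<in> ?N. heap_hom f \<or> heap_antihom f"
    then show "indecomposable G"
      unfolding indecomposable_def
      using decomposable_imp_normalizer_not_heap_map[OF assms(3)] by blast
  next
    assume "indecomposable G"
    then show "\<forall>f \<in> ?N. heap_hom f \<or> heap_antihom f"
      using indecomposable_imp_normalizer_heap_map[OF assms(3)] by blast
  qed
  finally show ?thesis
    unfolding generate_Hol_inversion .
qed

end
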